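(* The budget-adaptivity gap of SBMSm is at least $e/(e-1)$: for every $\epsilon>0$ there is an instance $I$ of SBMSm (satisfying the standing assumptions below) such that $\sigma(\pi^* )/\sigma(\pi)>\frac{e}{e-1}-\epsilon$, where $\pi^*$ is an optimal multi-round adaptive policy and $\pi$ an optimal partially adaptive policy for $I$.
   Context: An instance of SBMSm is $I=(T,B,V,H,(\mathcal P_t)_{t\in[T]},(f_t)_{t\in[T]})$: $T\ge2$ rounds; integer budget $B\ge0$; a finite set $V$ of $n\ge2$ items; each item $v$ has a set $H(v)$ of local states, $H=\prod_vH(v)$; at round $t$ a state $\eta_t\in H$ is drawn from $\mathcal P_t$, independently across rounds; $f_t:2^V\times H\to\mathbb R_{\ge0}$. A multi-round adaptive policy starts at round $1$ with all $S_t=\emptyset$; at each step it either selects an item $v\notin S_t$ of the current round $t$, adds it to $S_t$ and observes $\eta_t(v)$, or moves on to round $t+1$ (never returning); it stops when $t>T$ or $\sum_t|S_t|=B$; decisions may depend on all observations so far. Its value is $\sigma(\pi)=\mathbb E[\sum_tf_t(S_t,\eta_t)]$. A partially adaptive policy first fixes, without any observation, a budget vector $(b_1,\dots,b_T)$ of non-negative integers with $\sum_tb_t\le B$, and then at each round $t$ adaptively selects $b_t$ items. The budget-adaptivity gap of SBMSm is the supremum over instances of $\sigma(\pi^* )/\sigma(\pi)$. Standing assumptions on instances: polynomial boundedness (marginal increments of each $f_t$ bounded by some $\Lambda>0$ and some $\mathbb E[f_t(\{v\},\eta_t)]\ge\lambda>0$, with $\Lambda,1/\lambda$ polynomial in the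 instance size), monotonicity of each $f_t(\cdot,\eta)$, adaptive submodularity ($\Delta_t(v\mid\langle S\rangle)\ge\Delta_t(v\mid\langle S'\rangle)$ whenever the partial state $\langle S\rangle$ is a sub-state of $\langle S'\rangle$, where $\Delta_t(v\mid\langle S\rangle)$ is the expected marginal gain of $v$ at round $t$ conditioned on $\langle S\rangle$) and strong adaptive submodularity (the expected gain of any adaptive selection of $k$ further items after observing a partial state is at most the optimal expected value of a single-round adaptive policy at that round selecting $k$ items). *)

theory Defs
  imports "HOL-Probability.Probability" "HOL-Computational_Algebra.Polynomial"
begin

(* Rounds are numbered 1, ..., rounds I; state_dist and objective are irrelevant outside this range. *)
record ('v, 'h) sbmsm =
  rounds :: nat
  budget :: nat
  items :: "'v set"
  local_states :: "'v \<Rightarrow> 'h set"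
  state_dist :: "nat \<Rightarrow> ('v \<Rightarrow> 'h) pmf"
  objective :: "nat \<Rightarrow> 'v set \<Rightarrow> ('v \<Rightarrow> 'h) \<Rightarrow> real"

definition states :: "('v, 'h) sbmsm \<Rightarrow> ('v \<Rightarrow> 'h) set" where
  "states I = PiE (items I) (local_states I)"

(* The integrability clause only says that the expectations of objective values exist. *)
definition sbmsm_instance :: "('v, 'h) sbmsm \<Rightarrow> bool" where
  "sbmsm_instance I \<longleftrightarrow>
     rounds I \<ge> 2 \<and> finite (items I) \<and> card (items I) \<ge> 2 \<and>
     (\<forall>t\<in>{1..rounds I}. set_pmf (state_dist I t) \<subseteq> states I) \<and>
     (\<forall>t\<in>{1..rounds I}. \<forall>S\<subseteq>items I. \<forall>\<eta>\<in>states I. 0 \<le> objective I t S \<eta>) \<and>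
     (\<forall>t\<in>{1..rounds I}. \<forall>S\<subseteq>items I. integrable (measure_pmf (state_dist I t)) (objective I t S))"

datatype 'v action = Select 'v | Advance

(* An observation assigns to every round the partial state observed there: its domain is the set
   of items selected at that round so far. *)
type_synonym ('v, 'h) obs = "nat \<Rightarrow> 'v \<rightharpoonup> 'h"

type_synonym ('v, 'h) policy = "nat \<Rightarrow> ('v, 'h) obs \<Rightarrow> 'v action"

definition valid_obs :: "('v, 'h) sbmsm \<Rightarrow> ('v, 'h) obs \<Rightarrow> bool" where
  "valid_obs I ob \<longleftrightarrow>
     (\<forall>t. dom (ob t) \<subseteq> items I \<and> (\<forall>v h. ob t v = Some h \<longrightarrow> h \<in> local_states I v))"

definition adaptive_policy :: "('v, 'h) sbmsm \<Rightarrow> ('v, 'h) policy \<Rightarrow> bool" where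
  "adaptive_policy I \<pi> \<longleftrightarrow>
     (\<forall>t\<in>{1..rounds I}. \<forall>ob v. valid_obs I ob \<longrightarrow> \<pi> t ob = Select v \<longrightarrow> v \<in> items I - dom (ob t))"

definition spent :: "('v, 'h) sbmsm \<Rightarrow> ('v, 'h) obs \<Rightarrow> nat" where
  "spent I ob = (\<Sum>t=1..rounds I. card (dom (ob t)))"

definition halted :: "('v, 'h) sbmsm \<Rightarrow> nat \<times> ('v, 'h) obs \<Rightarrow> bool" where
  "halted I c \<longleftrightarrow> fst c > rounds I \<or> spent I (snd c) = budget I"

definition policy_step ::
  "('v, 'h) sbmsm \<Rightarrow> ('v, 'h) policy \<Rightarrow> (nat \<Rightarrow> 'v \<Rightarrow> 'h) \<Rightarrow>
     nat \<times> ('v, 'h) obs \<Rightarrow> nat \<times> ('v, 'h) obs" where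
  "policy_step I \<pi> \<eta> c =
     (if halted I c then c
      else case c of (t, ob) \<Rightarrow>
        (case \<pi> t ob of
           Select v \<Rightarrow> (t, ob(t := (ob t)(v \<mapsto> \<eta> t v)))
         | Advance \<Rightarrow> (Suc t, ob)))"

(* Every step of an adaptive policy either advances the round or spends one unit of budget, so
   rounds + budget many steps reach a halted configuration (lemma run_policy_halted below). *)
definition run_policy ::
  "('v, 'h) sbmsm \<Rightarrow> ('v, 'h) policy \<Rightarrow> (nat \<Rightarrow> 'v \<Rightarrow> 'h) \<Rightarrow> nat \<times> ('v, 'h) obs" where
  "run_policy I \<pi> \<eta> = (policy_step I \<pi> \<eta> ^^ (rounds I + budget I)) (1, \<lambda>_. Map.empty)"

definition selected ::
  "('v, 'h) sbmsm \<Rightarrow> ('v, 'h) policy \<Rightarrow> (nat \<Rightarrow> 'v \<Rightarrow> 'h) \<Rightarrow> nat \<Rightarrow> 'v set" where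
  "selected I \<pi> \<eta> t = dom (snd (run_policy I \<pi> \<eta>) t)"

definition policy_value :: "('v, 'h) sbmsm \<Rightarrow> ('v, 'h) policy \<Rightarrow> real" where
  "policy_value I \<pi> =
     measure_pmf.expectation (Pi_pmf {1..rounds I} undefined (state_dist I))
       (\<lambda>\<eta>. \<Sum>t=1..rounds I. objective I t (selected I \<pi> \<eta> t) (\<eta> t))"

(* The clause on actions forces the policy to select exactly b t items at every round t; in
   particular it can only hold if b t \<le> card (items I). The policy may still look at observations
   of earlier rounds when choosing which items to select. *)
definition partially_adaptive_policy :: "('v, 'h) sbmsm \<Rightarrow> ('v, 'h) policy \<Rightarrow> bool" where
  "partially_adaptive_policy I \<pi> \<longleftrightarrow> adaptive_policy I \<pi> \<and>
     (\<exists>b :: nat \<Rightarrow> nat. (\<Sum>t=1..rounds I. b t) \<le> budget I \<and>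
        (\<forall>t\<in>{1..rounds I}. \<forall>ob. valid_obs I ob \<longrightarrow>
           ((\<exists>v. \<pi> t ob = Select v) \<longleftrightarrow> card (dom (ob t)) < b t)))"

definition optimal_adaptive :: "('v, 'h) sbmsm \<Rightarrow> ('v, 'h) policy \<Rightarrow> bool" where
  "optimal_adaptive I \<pi> \<longleftrightarrow> adaptive_policy I \<pi> \<and>
     (\<forall>\<pi>'. adaptive_policy I \<pi>' \<longrightarrow> policy_value I \<pi>' \<le> policy_value I \<pi>)"

definition optimal_partially_adaptive :: "('v, 'h) sbmsm \<Rightarrow> ('v, 'h) policy \<Rightarrow> bool" where
  "optimal_partially_adaptive I \<pi> \<longleftrightarrow> partially_adaptive_policy I \<pi> \<and>
     (\<forall>\<pi>'. partially_adaptive_policy I \<pi>' \<longrightarrow> policy_value I \<pi>' \<le> policy_value I \<pi>)"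

definition compatible :: "('v \<rightharpoonup> 'h) \<Rightarrow> ('v \<Rightarrow> 'h) set" where
  "compatible \<psi> = {\<eta>. \<forall>v\<in>dom \<psi>. \<psi> v = Some (\<eta> v)}"

(* Only partial states of positive probability are considered: conditioning on others is
   meaningless. *)
definition partial_states :: "('v, 'h) sbmsm \<Rightarrow> nat \<Rightarrow> ('v \<rightharpoonup> 'h) set" where
  "partial_states I t = {\<psi>. dom \<psi> \<subseteq> items I \<and> set_pmf (state_dist I t) \<inter> compatible \<psi> \<noteq> {}}"

definition posterior :: "('v, 'h) sbmsm \<Rightarrow> nat \<Rightarrow> ('v \<rightharpoonup> 'h) \<Rightarrow> ('v \<Rightarrow> 'h) pmf" where
  "posterior I t \<psi> = cond_pmf (state_dist I t) (compatible \<psi>)"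

definition marginal_gain :: "('v, 'h) sbmsm \<Rightarrow> nat \<Rightarrow> 'v \<Rightarrow> ('v \<rightharpoonup> 'h) \<Rightarrow> real" where
  "marginal_gain I t v \<psi> = measure_pmf.expectation (posterior I t \<psi>)
     (\<lambda>\<eta>. objective I t (insert v (dom \<psi>)) \<eta> - objective I t (dom \<psi>) \<eta>)"

definition single_round_policy :: "('v, 'h) sbmsm \<Rightarrow> (('v \<rightharpoonup> 'h) \<Rightarrow> 'v) \<Rightarrow> bool" where
  "single_round_policy I s \<longleftrightarrow> (\<forall>\<psi>. dom \<psi> \<subset> items I \<longrightarrow> s \<psi> \<in> items I - dom \<psi>)"

definition extend :: "(('v \<rightharpoonup> 'h) \<Rightarrow> 'v) \<Rightarrow> ('v \<Rightarrow> 'h) \<Rightarrow> nat \<Rightarrow> ('v \<rightharpoonup> 'h) \<Rightarrow> ('v \<rightharpoonup> 'h)" where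
  "extend s \<eta> k = ((\<lambda>\<psi>. \<psi>(s \<psi> \<mapsto> \<eta> (s \<psi>))) ^^ k)"

definition adaptive_gain ::
  "('v, 'h) sbmsm \<Rightarrow> nat \<Rightarrow> (('v \<rightharpoonup> 'h) \<Rightarrow> 'v) \<Rightarrow> nat \<Rightarrow> ('v \<rightharpoonup> 'h) \<Rightarrow> real" where
  "adaptive_gain I t s k \<psi> = measure_pmf.expectation (posterior I t \<psi>)
     (\<lambda>\<eta>. objective I t (dom (extend s \<eta> k \<psi>)) \<eta> - objective I t (dom \<psi>) \<eta>)"

definition single_round_value ::
  "('v, 'h) sbmsm \<Rightarrow> nat \<Rightarrow> (('v \<rightharpoonup> 'h) \<Rightarrow> 'v) \<Rightarrow> nat \<Rightarrow> real" where
  "single_round_value I t s k = measure_pmf.expectation (state_dist I t)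
     (\<lambda>\<eta>. objective I t (dom (extend s \<eta> k Map.empty)) \<eta>)"

definition opt_single_round_value :: "('v, 'h) sbmsm \<Rightarrow> nat \<Rightarrow> nat \<Rightarrow> real" where
  "opt_single_round_value I t k = (SUP s\<in>Collect (single_round_policy I). single_round_value I t s k)"

(* Rounds and items already bound the length of any explicit encoding from below, so a bound
   polynomial in this quantity is also polynomial in the encoding length. *)
definition instance_size :: "('v, 'h) sbmsm \<Rightarrow> nat" where
  "instance_size I = card (items I) + rounds I"

(* The polynomial p is a parameter: for a single instance the existence of some polynomial bound
   would say nothing, so p has to be common to a whole class of instances. *)
definition polynomially_bounded :: "real poly \<Rightarrow> ('v, 'h) sbmsm \<Rightarrow> bool" where
  "polynomially_bounded p I \<longleftrightarrow>
     (\<exists>\<Lambda> l :: real. \<Lambda> > 0 \<and> l > 0 \<and>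
        (\<forall>t\<in>{1..rounds I}. \<forall>S\<subseteq>items I. \<forall>v\<in>items I. \<forall>\<eta>\<in>states I.
           objective I t (insert v S) \<eta> - objective I t S \<eta> \<le> \<Lambda>) \<and>
        (\<exists>t\<in>{1..rounds I}. \<exists>v\<in>items I. measure_pmf.expectation (state_dist I t) (objective I t {v}) \<ge> l) \<and>
        \<Lambda> \<le> poly p (real (instance_size I)) \<and> 1 / l \<le> poly p (real (instance_size I)))"

definition monotone_objective :: "('v, 'h) sbmsm \<Rightarrow> bool" where
  "monotone_objective I \<longleftrightarrow>
     (\<forall>t\<in>{1..rounds I}. \<forall>\<eta>\<in>states I. \<forall>S S'. S \<subseteq> S' \<longrightarrow> S' \<subseteq> items I \<longrightarrow>
        objective I t S \<eta> \<le> objective I t S' \<eta>)"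

definition adaptive_submodular :: "('v, 'h) sbmsm \<Rightarrow> bool" where
  "adaptive_submodular I \<longleftrightarrow>
     (\<forall>t\<in>{1..rounds I}. \<forall>\<psi>\<in>partial_states I t. \<forall>\<psi>'\<in>partial_states I t. \<forall>v\<in>items I.
        \<psi> \<subseteq>\<^sub>m \<psi>' \<longrightarrow> marginal_gain I t v \<psi>' \<le> marginal_gain I t v \<psi>)"

definition strongly_adaptive_submodular :: "('v, 'h) sbmsm \<Rightarrow> bool" where
  "strongly_adaptive_submodular I \<longleftrightarrow>
     (\<forall>t\<in>{1..rounds I}. \<forall>\<psi>\<in>partial_states I t. \<forall>s k.
        single_round_policy I s \<longrightarrow> k \<le> card (items I) - card (dom \<psi>) \<longrightarrow>
        adaptive_gain I t s k \<psi> \<le> opt_single_round_value I t k)"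

definition standing_assumptions :: "real poly \<Rightarrow> ('v, 'h) sbmsm \<Rightarrow> bool" where
  "standing_assumptions p I \<longleftrightarrow> polynomially_bounded p I \<and> monotone_objective I \<and>
     adaptive_submodular I \<and> strongly_adaptive_submodular I"

(* Taking items and local states in nat is no restriction: items are finite in number and the
   distributions are discrete, so every instance can be relabelled. *)
definition budget_adaptivity_gap :: "real poly \<Rightarrow> ereal" where
  "budget_adaptivity_gap p =
     Sup {ereal (policy_value I \<pi>opt / policy_value I \<pi>) | (I :: (nat, nat) sbmsm) \<pi>opt \<pi>.
            sbmsm_instance I \<and> standing_assumptions p I \<and>
            optimal_adaptive I \<pi>opt \<and> optimal_partially_adaptive I \<pi> \<and> policy_value I \<pi> > 0}"

lemma spent_update:
  assumes "valid_obs I ob" "finite (items I)" "t \<in> {1..rounds I}" "v \<notin> dom (ob t)"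
  shows "spent I (ob(t := (ob t)(v \<mapsto> h))) = Suc (spent I ob)"
proof -
  have "finite (dom (ob t))"
    using assms(1,2) finite_subset unfolding valid_obs_def by blast
  moreover have "(\<Sum>s\<in>{1..rounds I} - {t}. card (dom ((ob(t := (ob t)(v \<mapsto> h))) s)))
      = (\<Sum>s\<in>{1..rounds I} - {t}. card (dom (ob s)))"
    by (rule sum.cong) auto
  ultimately show ?thesis
    using assms(4) sum.remove[of "{1..rounds I}" t "\<lambda>s. card (dom ((ob(t := (ob t)(v \<mapsto> h))) s))"]
      sum.remove[of "{1..rounds I}" t "\<lambda>s. card (dom (ob s))"] assms(3)
    unfolding spent_def by simp
qed

lemma run_policy_halted:
  assumes inst: "sbmsm_instance I" and pol: "adaptive_policy I \<pi>"
    and \<eta>: "\<And>t. t \<in> {1..rounds I} \<Longrightarrow> \<eta> t \<in> states I"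
  shows "halted I (run_policy I \<pi> \<eta>)" "valid_obs I (snd (run_policy I \<pi> \<eta>))"
    "spent I (snd (run_policy I \<pi> \<eta>)) \<le> budget I"
proof -
  have fin: "finite (items I)" using inst by (simp add: sbmsm_instance_def)
  define c where "c n = (policy_step I \<pi> \<eta> ^^ n) (1, \<lambda>_. Map.empty)" for n
  have inv: "fst (c n) \<ge> 1 \<and> valid_obs I (snd (c n)) \<and> spent I (snd (c n)) \<le> budget I \<and>
      (halted I (c n) \<or> fst (c n) + spent I (snd (c n)) = Suc n)" for n
  proof (induction n)
    case 0
    show ?case by (simp add: c_def valid_obs_def spent_def)
  next
    case (Suc n)
    obtain t ob where tw: "c n = (t, ob)" by fastforce
    have step: "c (Suc n) = policy_step I \<pi> \<eta> (t, ob)" using tw by (simp add: c_def)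
    show ?case
    proof (cases "halted I (t, ob)")
      case True
      then show ?thesis using Suc step tw by (simp add: policy_step_def)
    next
      case False
      then have t: "t \<in> {1..rounds I}" and lt: "spent I ob < budget I"
        and val: "valid_obs I ob" and eq: "t + spent I ob = Suc n"
        using Suc tw by (auto simp: halted_def)
      show ?thesis
      proof (cases "\<pi> t ob")
        case Advance
        then show ?thesis using False step val eq lt by (simp add: policy_step_def)
      next
        case (Select v)
        then have v: "v \<in> items I" "v \<notin> dom (ob t)"
          using pol t val unfolding adaptive_policy_def by blast+
        have "\<eta> t v \<in> local_states I v" using \<eta>[OF t] v(1) by (auto simp: states_def)
        then have "valid_obs I (ob(t := (ob t)(v \<mapsto> \<eta> t v)))"
          using val v(1) by (auto simp: valid_obs_def split: if_splits)
        then show ?thesis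
          using False step eq lt t Select spent_update[OF val fin t v(2)]
          by (simp add: policy_step_def del: fun_upd_apply)
      qed
    qed
  qed
  have "run_policy I \<pi> \<eta> = c (rounds I + budget I)" by (simp add: run_policy_def c_def)
  then show "halted I (run_policy I \<pi> \<eta>)" "valid_obs I (snd (run_policy I \<pi> \<eta>))"
    "spent I (snd (run_policy I \<pi> \<eta>)) \<le> budget I"
    using inv[of "rounds I + budget I"] by (auto simp: halted_def)
qed

end

theory Submission
  imports Defs "HOL-Real_Asymp.Real_Asymp"
begin

text \<open>In every round the items are independent trials with success probability \<open>q = 1 / m\<close>, and the
  objective asks whether a success has been found; the budget is \<open>T * m\<close>. A partially adaptive
  policy gains \<open>1 - (1 - q) ^ b\<close> in a round of budget \<open>b\<close>, hence by convexity at most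
  \<open>T * (1 - (1 - 1 / m) ^ m)\<close> in total. Leaving a round right after its first success instead
  yields the expected minimum of \<open>T\<close> and a binomial variable of mean \<open>T\<close>, which is
  \<open>T - O(sqrt T)\<close>. For \<open>T = m\<close> tending to infinity the ratio tends to \<open>e / (e - 1)\<close>.\<close>

section \<open>Resampling coordinates of product distributions\<close>

lemma expectation_bind_finite:
  fixes g :: "'b \<Rightarrow> real"
  assumes "finite (set_pmf p)" "\<And>x. x \<in> set_pmf p \<Longrightarrow> finite (set_pmf (f x))"
  shows "measure_pmf.expectation (p \<bind> f) g
    = measure_pmf.expectation p (\<lambda>x. measure_pmf.expectation (f x) g)"
  using pmf_expectation_bind[OF assms(1), of f p g] assms
  by (simp add: integral_measure_pmf[OF assms(1)])

lemma finite_set_Pi_pmf: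
  assumes "finite A" "\<And>x. x \<in> A \<Longrightarrow> finite (set_pmf (p x))"
  shows "finite (set_pmf (Pi_pmf A d p))"
  using assms by (simp add: set_Pi_pmf finite_PiE_dflt)

text \<open>Overwriting coordinate \<open>a\<close> by a fresh independent draw preserves the law.
  The product over all of \<open>A\<close> reappears on the right, so later inductions never change
  the measure.\<close>

lemma Pi_pmf_resample:
  assumes "finite A" "a \<in> A"
  shows "Pi_pmf A d p = do {h \<leftarrow> p a; f \<leftarrow> Pi_pmf A d p; return_pmf (f(a := h))}"
proof -
  have A: "A = insert a (A - {a})" using assms by auto
  have P: "Pi_pmf A d p = do {y \<leftarrow> p a; f \<leftarrow> Pi_pmf (A - {a}) d p; return_pmf (f(a := y))}"
    by (subst A, subst Pi_pmf_insert') (use assms in auto)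
  show ?thesis
    by (subst (2) P) (simp add: P bind_assoc_pmf bind_return_pmf)
qed

lemma expectation_Pi_pmf_resample:
  fixes F :: "('a \<Rightarrow> 'b) \<Rightarrow> real"
  assumes "finite A" "a \<in> A" "\<And>x. x \<in> A \<Longrightarrow> finite (set_pmf (p x))"
  shows "measure_pmf.expectation (Pi_pmf A d p) F
    = measure_pmf.expectation (p a) (\<lambda>h. measure_pmf.expectation (Pi_pmf A d p) (\<lambda>f. F (f(a := h))))"
  by (subst Pi_pmf_resample[OF assms(1,2)])
    (use assms in \<open>simp add: expectation_bind_finite finite_set_Pi_pmf\<close>)

text \<open>The outer resampling identity, applied on both sides, exposes a complete value at
  \<open>t\<close>; the inner one redraws coordinate \<open>a\<close> within it.\<close>

lemma expectation_Pi_pmf_resample2: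
  fixes F :: "('a \<Rightarrow> 'b \<Rightarrow> 'c) \<Rightarrow> real" and d d'
  assumes "finite R" "t \<in> R" "finite A" "a \<in> A" "\<And>x. x \<in> A \<Longrightarrow> finite (set_pmf (p x))"
  defines "M \<equiv> Pi_pmf R d (\<lambda>_. Pi_pmf A d' p)"
  shows "measure_pmf.expectation M F
    = measure_pmf.expectation (p a) (\<lambda>h. measure_pmf.expectation M (\<lambda>\<eta>. F (\<eta>(t := (\<eta> t)(a := h)))))"
proof -
  have outer: "measure_pmf.expectation M G = measure_pmf.expectation (Pi_pmf A d' p)
      (\<lambda>x. measure_pmf.expectation M (\<lambda>\<eta>. G (\<eta>(t := x))))" for G :: "_ \<Rightarrow> real"
    unfolding M_def using assms by (intro expectation_Pi_pmf_resample) (auto intro: finite_set_Pi_pmf)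
  have "measure_pmf.expectation M F = measure_pmf.expectation (p a) (\<lambda>h.
      measure_pmf.expectation (Pi_pmf A d' p) (\<lambda>x.
        measure_pmf.expectation M (\<lambda>\<eta>. F (\<eta>(t := x(a := h))))))"
    unfolding outer[of F] using assms by (intro expectation_Pi_pmf_resample) auto
  then show ?thesis
    by (subst outer) simp
qed

section \<open>Conditioning a product distribution on observed coordinates\<close>

definition override :: "('a \<rightharpoonup> 'b) \<Rightarrow> ('a \<Rightarrow> 'b) \<Rightarrow> 'a \<Rightarrow> 'b" where
  "override \<psi> \<eta> v = (case \<psi> v of None \<Rightarrow> \<eta> v | Some h \<Rightarrow> h)"

lemma override_empty [simp]: "override Map.empty \<eta> = \<eta>"
  by (auto simp: override_def)

lemma override_None: "v \<notin> dom \<psi> \<Longrightarrow> override \<psi> \<eta> v = \<eta> v"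
  by (auto simp: override_def domIff)

lemma override_upd: "v \<notin> dom \<psi> \<Longrightarrow> override \<psi> (\<eta>(v := h)) = override (\<psi>(v \<mapsto> h)) \<eta>"
  by (auto simp: override_def fun_eq_iff domIff split: option.split)

text \<open>Independence: fixing the coordinates in \<open>dom \<psi>\<close> does not affect the
  law of the others. Conditioning on \<psi> thereby becomes overwriting with
  \<open>override \<psi>\<close> under the unconditioned measure.\<close>

lemma expectation_compatible:
  fixes p :: "'a \<Rightarrow> 'b pmf" and F :: "('a \<Rightarrow> 'b) \<Rightarrow> real" and d
  assumes "finite A" "\<And>x. x \<in> A \<Longrightarrow> finite (set_pmf (p x))" "dom \<psi> \<subseteq> A"
  defines "P \<equiv> Pi_pmf A d p"
  shows "measure_pmf.expectation P (\<lambda>\<eta>. indicator (compatible \<psi>) \<eta> * F \<eta>)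
    = measure_pmf.prob P (compatible \<psi>) * measure_pmf.expectation P (\<lambda>\<eta>. F (override \<psi> \<eta>))"
proof -
  have "finite (dom \<psi>)" using assms finite_subset by blast
  \<comment> \<open>The constant must be uniform in \<open>F\<close>, because the induction
    hypothesis is applied to \<open>F\<close> times the indicator of one more coordinate. Its value
    is found at the end by taking \<open>F\<close> to be 1.\<close>
  then have "\<exists>c. \<forall>F :: _ \<Rightarrow> real. measure_pmf.expectation P (\<lambda>\<eta>. indicator (compatible \<psi>) \<eta> * F \<eta>)
      = c * measure_pmf.expectation P (\<lambda>\<eta>. F (override \<psi> \<eta>))"
    using assms(3)
  proof (induction "dom \<psi>" arbitrary: \<psi> rule: finite_induct)
    case empty
    then have "\<psi> = Map.empty" by auto
    then show ?case by (intro exI[of _ 1]) (simp add: compatible_def)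
  next
    case (insert v D)
    define \<phi> where "\<phi> = \<psi>(v := None)"
    obtain h where h: "\<psi> v = Some h" using insert.hyps(4) by auto
    have \<phi>: "dom \<phi> = D" "D \<subseteq> A" "v \<in> A" "v \<notin> dom \<phi>" "\<psi> = \<phi>(v \<mapsto> h)"
      using insert.hyps(2) insert.prems h by (auto simp: \<phi>_def insert.hyps(4)[symmetric])
    obtain c where c: "\<And>F :: _ \<Rightarrow> real. measure_pmf.expectation P (\<lambda>\<eta>. indicator (compatible \<phi>) \<eta> * F \<eta>)
      = c * measure_pmf.expectation P (\<lambda>\<eta>. F (override \<phi> \<eta>))"
      using insert.hyps(3)[of \<phi>] \<phi> by auto
    have "measure_pmf.expectation P (\<lambda>\<eta>. indicator (compatible \<psi>) \<eta> * F \<eta>)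
        = c * pmf (p v) h * measure_pmf.expectation P (\<lambda>\<eta>. F (override \<psi> \<eta>))" for F :: "_ \<Rightarrow> real"
    proof -
      have "(\<lambda>\<eta>. indicator (compatible \<psi>) \<eta> * F \<eta>)
          = (\<lambda>\<eta>. indicator (compatible \<phi>) \<eta> * (of_bool (\<eta> v = h) * F \<eta>))"
        using \<phi>(4,5) by (auto simp: compatible_def indicator_def fun_eq_iff)
      then have "measure_pmf.expectation P (\<lambda>\<eta>. indicator (compatible \<psi>) \<eta> * F \<eta>)
          = c * measure_pmf.expectation P (\<lambda>\<eta>. of_bool (\<eta> v = h) * F (override \<phi> \<eta>))"
        using \<phi>(4) by (simp add: c override_None)
      \<comment> \<open>Redrawing coordinate \<open>v\<close> turns the event into one about the
        fresh value \<open>h'\<close>, so only \<open>h' = h\<close> contributes.\<close>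
      also have "measure_pmf.expectation P (\<lambda>\<eta>. of_bool (\<eta> v = h) * F (override \<phi> \<eta>))
          = measure_pmf.expectation (p v) (\<lambda>h'. measure_pmf.expectation P
              (\<lambda>\<eta>. of_bool (h' = h) * F (override (\<phi>(v \<mapsto> h')) \<eta>)))"
        unfolding P_def
        by (subst expectation_Pi_pmf_resample[of A v]) (use assms \<phi> in \<open>auto simp: override_upd\<close>)
      also have "\<dots> = pmf (p v) h * measure_pmf.expectation P (\<lambda>\<eta>. F (override \<psi> \<eta>))"
        by (subst integral_measure_pmf[of "{h}"]) (auto simp: \<phi>(5))
      finally show ?thesis by simp
    qed
    then show ?case by blast
  qed
  then obtain c where c: "\<And>F :: _ \<Rightarrow> real. measure_pmf.expectation P (\<lambda>\<eta>. indicator (compatible \<psi>) \<eta> * F \<eta>)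
      = c * measure_pmf.expectation P (\<lambda>\<eta>. F (override \<psi> \<eta>))" by blast
  from c[of "\<lambda>_. 1"] have "c = measure_pmf.prob P (compatible \<psi>)" by simp
  with c show ?thesis by simp
qed

lemma expectation_cond_pmf:
  fixes F :: "'a \<Rightarrow> real"
  assumes fin: "finite (set_pmf P)" and ne: "set_pmf P \<inter> C \<noteq> {}"
  shows "measure_pmf.expectation (cond_pmf P C) F
    = measure_pmf.expectation P (\<lambda>x. indicator C x * F x) / measure_pmf.prob P C"
  using assms
  by (subst (1 2) integral_measure_pmf[OF fin])
    (auto simp: pmf_cond[OF ne] indicator_def sum_divide_distrib intro!: sum.cong split: if_splits)

lemma expectation_cond_Pi_pmf:
  fixes p :: "'a \<Rightarrow> 'b pmf" and F :: "('a \<Rightarrow> 'b) \<Rightarrow> real"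
  assumes "finite A" "\<And>x. x \<in> A \<Longrightarrow> finite (set_pmf (p x))" "dom \<psi> \<subseteq> A"
    and ne: "set_pmf (Pi_pmf A d p) \<inter> compatible \<psi> \<noteq> {}"
  shows "measure_pmf.expectation (cond_pmf (Pi_pmf A d p) (compatible \<psi>)) F
    = measure_pmf.expectation (Pi_pmf A d p) (\<lambda>\<eta>. F (override \<psi> \<eta>))"
proof -
  have "measure_pmf.prob (Pi_pmf A d p) (compatible \<psi>) > 0"
    using ne measure_pmf_posI by fast
  then show ?thesis
    using assms by (simp add: expectation_cond_pmf finite_set_Pi_pmf expectation_compatible)
qed

section \<open>Searching for a success among independent trials\<close>

declare One_nat_def [simp del]

definition bern :: "real \<Rightarrow> nat pmf" where
  "bern q = map_pmf of_bool (bernoulli_pmf q)"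

text \<open>There are as many items as units of budget, so no round runs out of items while budget
  is left.\<close>

definition search_instance :: "real \<Rightarrow> nat \<Rightarrow> nat \<Rightarrow> (nat, nat) sbmsm" where
  "search_instance q T n = \<lparr>rounds = T, budget = n, items = {..<n}, local_states = (\<lambda>_. {0, 1}),
     state_dist = (\<lambda>_. Pi_pmf {..<n} undefined (\<lambda>_. bern q)),
     objective = (\<lambda>_ S \<eta>. of_bool (\<exists>v\<in>S. \<eta> v = 1))\<rparr>"

locale search =
  fixes q :: real and T n :: nat
  assumes q: "0 < q" "q < 1" and T: "2 \<le> T" and n: "2 \<le> n"
begin

abbreviation I where "I \<equiv> search_instance q T n"

abbreviation P where "P \<equiv> Pi_pmf {..<n} undefined (\<lambda>_. bern q)"

abbreviation M where "M \<equiv> Pi_pmf {1..T} undefined (\<lambda>_. P)"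

lemma I_simps [simp]:
  "rounds I = T" "budget I = n" "items I = {..<n}" "local_states I v = {0, 1}"
  "state_dist I t = P" "objective I t S = (\<lambda>\<eta>. of_bool (\<exists>v\<in>S. \<eta> v = 1))"
  by (simp_all add: search_instance_def)

lemma state_dist_eq: "state_dist I = (\<lambda>_. P)"
  by (simp add: fun_eq_iff)

lemma set_bern [simp]: "set_pmf (bern q) = {0, 1}"
  using q by (auto simp: bern_def UNIV_bool)

lemma expectation_bern [simp]:
  fixes F :: "nat \<Rightarrow> real"
  shows "measure_pmf.expectation (bern q) F = q * F 1 + (1 - q) * F 0"
  using q by (simp add: bern_def mult.commute)

lemma set_P: "set_pmf P = states I"
  by (auto simp: states_def set_Pi_pmf PiE_dflt_def PiE_def extensional_def)

lemma finite_P: "finite (set_pmf P)"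
  by (intro finite_set_Pi_pmf) auto

lemma set_M: "\<eta> \<in> set_pmf M \<Longrightarrow> t \<in> {1..T} \<Longrightarrow> \<eta> t \<in> states I"
  by (auto simp: set_Pi_pmf PiE_dflt_def set_P)

lemma finite_M: "finite (set_pmf M)"
  by (intro finite_set_Pi_pmf finite_P) auto

lemma expectation_P_resample:
  fixes F :: "(nat \<Rightarrow> nat) \<Rightarrow> real"
  assumes "v < n"
  shows "measure_pmf.expectation P F = q * measure_pmf.expectation P (\<lambda>\<eta>. F (\<eta>(v := 1)))
    + (1 - q) * measure_pmf.expectation P (\<lambda>\<eta>. F (\<eta>(v := 0)))"
  by (subst expectation_Pi_pmf_resample[of "{..<n}" v]) (use assms in auto)

lemma expectation_M_resample:
  fixes F :: "(nat \<Rightarrow> nat \<Rightarrow> nat) \<Rightarrow> real"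
  assumes "t \<in> {1..T}" "v < n"
  shows "measure_pmf.expectation M F
    = q * measure_pmf.expectation M (\<lambda>\<eta>. F (\<eta>(t := (\<eta> t)(v := 1))))
    + (1 - q) * measure_pmf.expectation M (\<lambda>\<eta>. F (\<eta>(t := (\<eta> t)(v := 0))))"
  by (subst expectation_Pi_pmf_resample2[of "{1..T}" t "{..<n}" v]) (use assms in auto)

lemma is_instance: "sbmsm_instance I"
  using T n by (auto simp: sbmsm_instance_def set_P intro!: integrable_measure_pmf_finite finite_P)

section \<open>Gains in a single round and the standing assumptions\<close>

lemma expectation_posterior:
  fixes F :: "(nat \<Rightarrow> nat) \<Rightarrow> real"
  assumes "\<psi> \<in> partial_states I t"
  shows "measure_pmf.expectation (posterior I t \<psi>) F
    = measure_pmf.expectation P (\<lambda>\<eta>. F (override \<psi> \<eta>))"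
  using assms unfolding posterior_def I_simps
  by (intro expectation_cond_Pi_pmf) (auto simp: partial_states_def)

lemma success_override: "(\<exists>v\<in>dom \<psi>. override \<psi> \<eta> v = 1) \<longleftrightarrow> 1 \<in> ran \<psi>"
  by (force simp: ran_def override_def)

text \<open>Every selection is a fresh trial with success probability \<open>q\<close>, so all rules
  \<open>s\<close> are equally good: without a success in \<psi>, all \<open>k\<close> trials fail
  with probability \<open>(1 - q) ^ k\<close>. The bound on \<open>k\<close> guarantees that
  unselected items remain.\<close>

lemma expectation_extend:
  assumes "single_round_policy I s" "dom \<psi> \<subseteq> {..<n}" "k \<le> n - card (dom \<psi>)"
  shows "measure_pmf.expectation P
      (\<lambda>\<eta>. of_bool (\<exists>v\<in>dom (extend s (override \<psi> \<eta>) k \<psi>). override \<psi> \<eta> v = 1))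
    = 1 - of_bool (1 \<notin> ran \<psi>) * (1 - q) ^ k"
  using assms(2,3)
proof (induction k arbitrary: \<psi>)
  case 0
  show ?case by (simp add: extend_def success_override)
next
  case (Suc k)
  define v where "v = s \<psi>"
  have fin: "finite (dom \<psi>)" using Suc.prems finite_subset by blast
  have "card (dom \<psi>) \<noteq> n" using Suc.prems(2) by simp
  then have "dom \<psi> \<subset> items I" using Suc.prems(1) by auto
  then have "v \<in> items I - dom \<psi>"
    using assms(1) unfolding single_round_policy_def v_def by blast
  then have v: "v < n" "v \<notin> dom \<psi>" by simp_all
  have D: "dom (\<psi>(v \<mapsto> h)) \<subseteq> {..<n}" "k \<le> n - card (dom (\<psi>(v \<mapsto> h)))" for h :: nat
    using Suc.prems v fin by simp_all
  note IH = Suc.IH[OF D]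
  have step: "extend s \<eta> (Suc k) \<psi> = extend s \<eta> k (\<psi>(v \<mapsto> \<eta> v))" for \<eta>
    by (simp add: extend_def funpow_Suc_right v_def del: funpow.simps)
  have ov: "override (\<psi>(v \<mapsto> h)) \<eta> v = h" for h \<eta>
    by (simp add: override_def)
  have ran: "1 \<in> ran (\<psi>(v \<mapsto> h)) \<longleftrightarrow> 1 = h \<or> 1 \<in> ran \<psi>" for h
    using v(2) by (simp add: ran_map_upd domIff)
  \<comment> \<open>Once \<open>v\<close> is redrawn as \<open>h\<close>, this value moves from the
    state into the partial state, and the induction hypothesis for
    \<open>\<psi>(v \<mapsto> h)\<close> applies.\<close>
  have eq: "measure_pmf.expectation P
      (\<lambda>\<eta>. of_bool (\<exists>u\<in>dom (extend s (override \<psi> (\<eta>(v := h))) (Suc k) \<psi>).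
        override \<psi> (\<eta>(v := h)) u = 1)) = 1 - of_bool (1 \<notin> ran (\<psi>(v \<mapsto> h))) * (1 - q) ^ k" for h
    unfolding step override_upd[OF v(2)] ov by (rule IH)
  show ?case
    by (subst expectation_P_resample[OF v(1)]) (unfold eq ran, simp add: algebra_simps)
qed

lemma adaptive_gain_eq:
  assumes "single_round_policy I s" "\<psi> \<in> partial_states I t" "k \<le> n - card (dom \<psi>)"
  shows "adaptive_gain I t s k \<psi> = of_bool (1 \<notin> ran \<psi>) * (1 - (1 - q) ^ k)"
proof -
  have "dom \<psi> \<subseteq> {..<n}" using assms(2) by (auto simp: partial_states_def)
  then show ?thesis
    using assms expectation_extend[of s \<psi> k]
    by (simp add: adaptive_gain_def expectation_posterior success_override finite_P
        integrable_measure_pmf_finite)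
qed

lemma marginal_gain_eq:
  assumes "\<psi> \<in> partial_states I t" "v < n"
  shows "marginal_gain I t v \<psi> = of_bool (1 \<notin> ran \<psi> \<and> v \<notin> dom \<psi>) * q"
proof (cases "v \<in> dom \<psi>")
  case True
  then show ?thesis by (simp add: marginal_gain_def insert_absorb)
next
  case False
  have eq: "(of_bool (\<exists>u\<in>insert v (dom \<psi>). override \<psi> \<eta> u = 1) :: real)
      - of_bool (\<exists>u\<in>dom \<psi>. override \<psi> \<eta> u = 1) = of_bool (1 \<notin> ran \<psi> \<and> \<eta> v = 1)" for \<eta>
    using success_override[of \<psi> \<eta>] False by (auto simp: override_None)
  have "marginal_gain I t v \<psi> = measure_pmf.expectation P (\<lambda>\<eta>. of_bool (1 \<notin> ran \<psi> \<and> \<eta> v = 1))"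
    unfolding marginal_gain_def expectation_posterior[OF assms(1)] I_simps eq ..
  also have "\<dots> = of_bool (1 \<notin> ran \<psi>) * q"
    by (subst expectation_P_resample[OF assms(2)]) auto
  finally show ?thesis using False by simp
qed

text \<open>All single-round policies have the same value, so the supremum is that of a constant
  over a nonempty set.\<close>

lemma opt_single_round_value_eq:
  assumes "k \<le> n"
  shows "opt_single_round_value I t k = 1 - (1 - q) ^ k"
proof -
  have eq: "single_round_value I t s k = 1 - (1 - q) ^ k" if "single_round_policy I s" for s
    using expectation_extend[OF that, of Map.empty k] assms by (simp add: single_round_value_def)
  have "single_round_policy I (\<lambda>\<psi>. SOME v. v \<in> {..<n} - dom \<psi>)"
    unfolding single_round_policy_def I_simps by (metis ex_in_conv Diff_eq_empty_iff leD some_in_eq psubset_eq subset_antisym)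
  then have "Collect (single_round_policy I) \<noteq> {}" by blast
  moreover have "opt_single_round_value I t k = (SUP s\<in>Collect (single_round_policy I). 1 - (1 - q) ^ k)"
    unfolding opt_single_round_value_def by (intro SUP_cong) (auto simp: eq)
  ultimately show ?thesis by simp
qed

text \<open>Increments are at most 1 and a single item is worth \<open>q\<close>, so the identity
  polynomial serves as the bound. The marginal gain of \<open>v\<close> is \<open>q\<close> until a
  success or the selection of \<open>v\<close>, and 0 afterwards. An adaptive gain is either 0 or
  exactly the optimal single-round value.\<close>

lemma standing_assumptions_hold:
  assumes "1 / q \<le> real (n + T)"
  shows "standing_assumptions [:0, 1:] I"
  unfolding standing_assumptions_def
proof (intro conjI)
  have "measure_pmf.expectation P (\<lambda>\<eta>. of_bool (\<eta> 0 = 1)) = q"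
    by (subst expectation_P_resample[of 0]) (use n in auto)
  then have "\<exists>t\<in>{1..T}. \<exists>v<n. q \<le> measure_pmf.expectation P (\<lambda>\<eta>. of_bool (\<eta> v = 1))"
    using n T by (intro bexI[of _ 1] exI[of _ 0]) auto
  then show "polynomially_bounded [:0, 1:] I"
    unfolding polynomially_bounded_def using assms q T
    by - (rule exI[of _ 1], rule exI[of _ q], auto simp: instance_size_def Bex_def)
  show "monotone_objective I"
    by (auto simp: monotone_objective_def)
  show "adaptive_submodular I"
    unfolding adaptive_submodular_def
  proof (intro ballI impI)
    fix t \<psi> \<psi>' v
    assume *: "t \<in> {1..rounds I}" "\<psi> \<in> partial_states I t" "\<psi>' \<in> partial_states I t" "v \<in> items I"
      and sub: "\<psi> \<subseteq>\<^sub>m \<psi>'"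
    have "1 \<in> ran \<psi> \<Longrightarrow> 1 \<in> ran \<psi>'" "v \<in> dom \<psi> \<Longrightarrow> v \<in> dom \<psi>'"
      using sub by (force simp: map_le_def ran_def)+
    then show "marginal_gain I t v \<psi>' \<le> marginal_gain I t v \<psi>"
      using * q by (auto simp: marginal_gain_eq)
  qed
  show "strongly_adaptive_submodular I"
    unfolding strongly_adaptive_submodular_def
    using q by (auto simp: adaptive_gain_eq opt_single_round_value_eq power_le_one)
qed

section \<open>Policy values as a recursion over observations\<close>

abbreviation observe :: "(nat, nat) obs \<Rightarrow> nat \<Rightarrow> nat \<Rightarrow> nat \<Rightarrow> (nat, nat) obs" where
  "observe ob t v h \<equiv> ob(t := (ob t)(v \<mapsto> h))"

definition score :: "(nat, nat) obs \<Rightarrow> real" where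
  "score ob = (\<Sum>t=1..T. of_bool (1 \<in> ran (ob t)))"

text \<open>The value function of \<pi> with \<open>k\<close> steps left. Each item is sampled at
  the moment of its selection, so the recursion refers only to observations.\<close>

primrec expected_score :: "(nat, nat) policy \<Rightarrow> nat \<Rightarrow> nat \<Rightarrow> (nat, nat) obs \<Rightarrow> real" where
  "expected_score \<pi> 0 t ob = score ob"
| "expected_score \<pi> (Suc k) t ob =
     (if halted I (t, ob) then score ob
      else case \<pi> t ob of
        Select v \<Rightarrow> q * expected_score \<pi> k t (observe ob t v 1)
          + (1 - q) * expected_score \<pi> k t (observe ob t v 0)
      | Advance \<Rightarrow> expected_score \<pi> k (Suc t) ob)"

lemma policy_step_halted: "halted I c \<Longrightarrow> (policy_step I \<pi> \<eta> ^^ k) c = c"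
  by (induction k) (auto simp: policy_step_def)

lemma valid_obs_observe:
  "valid_obs I ob \<Longrightarrow> v < n \<Longrightarrow> h \<in> {0, 1} \<Longrightarrow> valid_obs I (observe ob t v h)"
  by (auto simp: valid_obs_def split: if_splits)

lemma finite_dom: "valid_obs I ob \<Longrightarrow> finite (dom (ob t))"
  unfolding valid_obs_def by (metis finite_lessThan finite_subset I_simps(3))

lemma override_resample:
  assumes "v \<notin> dom (ob t)"
  shows "(\<lambda>s. override (ob s) ((\<eta>(t := (\<eta> t)(v := h))) s)) = (\<lambda>s. override (observe ob t v h s) (\<eta> s))"
  using override_upd[OF assms] by (auto simp: fun_eq_iff)

text \<open>Deferred decisions: unobserved local states may be drawn at the moment they are observed.\<close>

lemma expectation_run_from:
  assumes "adaptive_policy I \<pi>" "valid_obs I ob" "1 \<le> t"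
  shows "measure_pmf.expectation M
      (\<lambda>\<eta>. score (snd ((policy_step I \<pi> (\<lambda>s. override (ob s) (\<eta> s)) ^^ k) (t, ob))))
    = expected_score \<pi> k t ob"
  using assms(2,3)
proof (induction k arbitrary: t ob)
  case 0
  show ?case by simp
next
  case (Suc k)
  show ?case
  proof (cases "halted I (t, ob)")
    case True
    then show ?thesis
      by (simp add: policy_step_halted del: funpow.simps)
  next
    case False
    then have t: "t \<in> {1..T}" using Suc.prems by (auto simp: halted_def)
    show ?thesis
    proof (cases "\<pi> t ob")
      case Advance
      have step: "policy_step I \<pi> \<eta> (t, ob) = (Suc t, ob)" for \<eta>
        using False Advance by (simp add: policy_step_def)
      show ?thesis
        using Suc.IH[OF Suc.prems(1), of "Suc t"] False Advance
        by (simp add: funpow_Suc_right step del: funpow.simps)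
    next
      case (Select v)
      then have v: "v < n" "v \<notin> dom (ob t)"
        using assms(1) t Suc.prems unfolding adaptive_policy_def by fastforce+
      have step: "policy_step I \<pi> (\<lambda>s. override (observe ob t v h s) (\<eta> s)) (t, ob)
          = (t, observe ob t v h)" for \<eta> h
        using False Select by (simp add: policy_step_def override_def)
      have "measure_pmf.expectation M (\<lambda>\<eta>. score (snd ((policy_step I \<pi>
            (\<lambda>s. override (ob s) ((\<eta>(t := (\<eta> t)(v := h))) s)) ^^ Suc k) (t, ob))))
          = expected_score \<pi> k t (observe ob t v h)" if "h \<in> {0, 1}" for h
        unfolding override_resample[of v ob t, OF v(2)] funpow_Suc_right comp_apply step
        by (rule Suc.IH[OF valid_obs_observe[OF Suc.prems(1) v(1) that] Suc.prems(2)])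
      then show ?thesis
        by (subst expectation_M_resample[OF t v(1)]) (use False Select in simp)
    qed
  qed
qed

text \<open>Observed values are copied from \<eta>; hence the objective of a run can be read off its
  observations.\<close>

lemma run_consistent:
  assumes "\<And>s v h. snd c s v = Some h \<Longrightarrow> \<eta> s v = h"
  shows "snd ((policy_step I \<pi> \<eta> ^^ k) c) s v = Some h \<Longrightarrow> \<eta> s v = h"
proof (induction k arbitrary: s v h)
  case 0
  then show ?case using assms by simp
next
  case (Suc k)
  obtain t ob where c: "(policy_step I \<pi> \<eta> ^^ k) c = (t, ob)" by fastforce
  then have "snd (policy_step I \<pi> \<eta> (t, ob)) s v = Some h" using Suc.prems by simp
  moreover have "ob s v = Some h \<Longrightarrow> \<eta> s v = h" using Suc.IH[of s v h] by (simp add: c)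
  ultimately show ?case
    by (auto simp: policy_step_def split: if_splits action.splits)
qed

lemma policy_value_eq:
  assumes "adaptive_policy I \<pi>"
  shows "policy_value I \<pi> = expected_score \<pi> (T + n) 1 (\<lambda>_. Map.empty)"
proof -
  have "(\<Sum>t=1..T. objective I t (selected I \<pi> \<eta> t) (\<eta> t)) = score (snd (run_policy I \<pi> \<eta>))" for \<eta>
  proof -
    have run: "\<eta> t v = h" if "snd (run_policy I \<pi> \<eta>) t v = Some h" for t v h
      by (rule run_consistent[OF _ that[unfolded run_policy_def]]) simp
    have "(\<exists>v\<in>dom (snd (run_policy I \<pi> \<eta>) t). \<eta> t v = 1)
        \<longleftrightarrow> 1 \<in> ran (snd (run_policy I \<pi> \<eta>) t)" for t
    proof
      assume "\<exists>v\<in>dom (snd (run_policy I \<pi> \<eta>) t). \<eta> t v = 1"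
      then obtain v h where vh: "snd (run_policy I \<pi> \<eta>) t v = Some h" "\<eta> t v = 1" by blast
      then show "1 \<in> ran (snd (run_policy I \<pi> \<eta>) t)"
        using run[OF vh(1)] by (intro ranI[of _ v]) simp
    next
      assume "1 \<in> ran (snd (run_policy I \<pi> \<eta>) t)"
      then obtain v where "snd (run_policy I \<pi> \<eta>) t v = Some 1" unfolding ran_def by blast
      then show "\<exists>v\<in>dom (snd (run_policy I \<pi> \<eta>) t). \<eta> t v = 1" using run by blast
    qed
    then show ?thesis by (simp add: score_def selected_def)
  qed
  then have "policy_value I \<pi> = measure_pmf.expectation M (\<lambda>\<eta>. score (snd (run_policy I \<pi> \<eta>)))"
    by (simp add: policy_value_def state_dist_eq)
  also have "\<dots> = expected_score \<pi> (T + n) 1 (\<lambda>_. Map.empty)"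
    using expectation_run_from[OF assms, of "\<lambda>_. Map.empty" 1 "T + n"]
    by (simp add: run_policy_def valid_obs_def)
  finally show ?thesis .
qed

lemma score_observe:
  assumes "t \<in> {1..T}" "1 \<notin> ran (ob t)" "v \<notin> dom (ob t)"
  shows "score (observe ob t v 1) = score ob + 1" "score (observe ob t v 0) = score ob"
proof -
  have "score (observe ob t v h) = score ob + of_bool (h = 1)" for h
  proof -
    have "(\<Sum>s\<in>{1..T} - {t}. of_bool (1 \<in> ran (observe ob t v h s)) :: real)
        = (\<Sum>s\<in>{1..T} - {t}. of_bool (1 \<in> ran (ob s)))"
      by (rule sum.cong) auto
    then show ?thesis
      using assms unfolding score_def sum.remove[OF finite_atLeastAtMost assms(1)]
      by (simp add: ran_map_upd domIff del: sum_of_bool_eq)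
  qed
  then show "score (observe ob t v 1) = score ob + 1" "score (observe ob t v 0) = score ob"
    by simp_all
qed

subsection \<open>Fixed budgets\<close>

text \<open>A round with remaining budget \<open>r\<close> and no success so far still succeeds with
  probability \<open>1 - (1 - q) ^ r\<close>, whatever the policy does.\<close>

definition fixed_term :: "(nat \<Rightarrow> nat) \<Rightarrow> nat \<Rightarrow> (nat, nat) obs \<Rightarrow> nat \<Rightarrow> real" where
  "fixed_term b t ob s = (if 1 \<in> ran (ob s) then 1 else if s < t then 0
     else 1 - (1 - q) ^ (b s - card (dom (ob s))))"

lemma score_le_fixed: "score ob \<le> (\<Sum>s=1..T. fixed_term b t ob s)"
  unfolding score_def using q by (intro sum_mono) (auto simp: fixed_term_def power_le_one)

text \<open>The bound is preserved by averaging over a trial and by advancing, and it dominates the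
  score wherever the recursion stops.\<close>

lemma expected_score_le_fixed:
  assumes "adaptive_policy I \<pi>" "valid_obs I ob" "1 \<le> t"
    and b: "\<And>t ob. t \<in> {1..T} \<Longrightarrow> valid_obs I ob
      \<Longrightarrow> (\<exists>v. \<pi> t ob = Select v) \<longleftrightarrow> card (dom (ob t)) < b t"
  shows "expected_score \<pi> k t ob \<le> (\<Sum>s=1..T. fixed_term b t ob s)"
  using assms(2,3)
proof (induction k arbitrary: t ob)
  case 0
  show ?case by (simp add: score_le_fixed)
next
  case (Suc k)
  show ?case
  proof (cases "halted I (t, ob)")
    case True
    then show ?thesis by (simp add: score_le_fixed)
  next
    case False
    then have t: "t \<in> {1..T}" using Suc.prems by (auto simp: halted_def)
    show ?thesis
    proof (cases "\<pi> t ob")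
      case Advance
      then have "b t \<le> card (dom (ob t))" using b[OF t Suc.prems(1)] by auto
      \<comment> \<open>The budget of round \<open>t\<close> is spent, so without a success its
        exponent is 0 and its term is 0, the value for a past round.\<close>
      then have "fixed_term b (Suc t) ob s = fixed_term b t ob s" for s
        by (cases "s = t") (auto simp: fixed_term_def)
      then show ?thesis
        using Suc.IH[OF Suc.prems(1), of "Suc t"] False Advance by simp
    next
      case (Select v)
      then have v: "v < n" "v \<notin> dom (ob t)"
        using assms(1) t Suc.prems unfolding adaptive_policy_def by fastforce+
      have lt: "card (dom (ob t)) < b t" using b[OF t Suc.prems(1)] Select by auto
      note fin = finite_dom[OF Suc.prems(1)]
      have IH: "expected_score \<pi> k t (observe ob t v h)
          \<le> (\<Sum>s=1..T. fixed_term b t (observe ob t v h) s)" if "h \<in> {0, 1}" for h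
        by (rule Suc.IH[OF valid_obs_observe[OF Suc.prems(1) v(1) that] Suc.prems(2)])
      \<comment> \<open>For round \<open>t\<close> before a success, with \<open>r\<close> trials
        left: \<open>q + (1 - q) * (1 - (1 - q) ^ (r - 1)) = 1 - (1 - q) ^ r\<close>.\<close>
      have mix: "q * fixed_term b t (observe ob t v 1) s + (1 - q) * fixed_term b t (observe ob t v 0) s
          = fixed_term b t ob s" for s
      proof (cases "s = t")
        case True
        have "b t - card (dom (ob t)) = Suc (b t - Suc (card (dom (ob t))))" using lt by simp
        then show ?thesis
          using True v fin by (simp add: fixed_term_def ran_map_upd domIff algebra_simps)
      next
        case False
        then show ?thesis by (simp add: fixed_term_def algebra_simps)
      qed
      have "expected_score \<pi> (Suc k) t ob \<le> q * (\<Sum>s=1..T. fixed_term b t (observe ob t v 1) s)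
          + (1 - q) * (\<Sum>s=1..T. fixed_term b t (observe ob t v 0) s)"
        using False Select q IH[of 0] IH[of 1] by (simp add: add_mono mult_left_mono)
      also have "\<dots> = (\<Sum>s=1..T. fixed_term b t ob s)"
        by (simp add: sum_distrib_left mix flip: sum.distrib)
      finally show ?thesis .
    qed
  qed
qed

lemma partially_adaptive_value_le:
  assumes "partially_adaptive_policy I \<pi>" and nm: "n = T * m"
  shows "policy_value I \<pi> \<le> T * (1 - (1 - q) ^ m)"
proof -
  obtain b where sum_b: "(\<Sum>t=1..T. b t) \<le> n"
    and b: "\<And>t ob. t \<in> {1..T} \<Longrightarrow> valid_obs I ob
      \<Longrightarrow> (\<exists>v. \<pi> t ob = Select v) \<longleftrightarrow> card (dom (ob t)) < b t"
    using assms(1) unfolding partially_adaptive_policy_def by auto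
  have \<pi>: "adaptive_policy I \<pi>" using assms(1) by (simp add: partially_adaptive_policy_def)
  \<comment> \<open>Writing powers of \<open>1 - q\<close> as exponentials reduces the tangent bound
    to 1 + x \<le> exp x.\<close>
  define c where "c = - ln (1 - q)"
  have c: "0 \<le> c" using q by (simp add: c_def)
  have pow: "(1 - q) ^ k = exp (- c * k)" for k
    using q by (simp add: c_def mult.commute exp_of_nat_mult)
  txt \<open>Tangent to the convex function \<open>r \<mapsto> (1 - q) ^ r\<close> at \<open>r = m\<close>.\<close>
  have tangent: "(1 - q) ^ m * (1 + c * (real m - real k)) \<le> (1 - q) ^ k" for k
  proof -
    have "exp (- c * m) * (1 + c * (real m - real k)) \<le> exp (- c * m) * exp (c * (real m - real k))"
      by (intro mult_left_mono exp_ge_add_one_self) auto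
    then show ?thesis by (simp add: pow algebra_simps flip: exp_add)
  qed
  have "(\<Sum>s=1..T. real (b s)) \<le> T * m"
    using sum_b nm by (metis of_nat_le_iff of_nat_mult of_nat_sum)
  \<comment> \<open>The tangent is nonincreasing in \<open>k\<close>, so leaving part of the budget
    unassigned does not help.\<close>
  then have "0 \<le> (1 - q) ^ m * c * (T * m - (\<Sum>s=1..T. real (b s)))"
    using c q by (intro mult_nonneg_nonneg) auto
  then have "T * (1 - q) ^ m \<le> (\<Sum>s=1..T. (1 - q) ^ m * (1 + c * (real m - real (b s))))"
    by (simp add: sum.distrib sum_subtractf algebra_simps flip: sum_distrib_left sum_distrib_right)
  also have "\<dots> \<le> (\<Sum>s=1..T. (1 - q) ^ b s)" by (intro sum_mono tangent)
  finally have "(\<Sum>s=1..T. 1 - (1 - q) ^ b s) \<le> T * (1 - (1 - q) ^ m)"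
    by (simp add: sum_subtractf algebra_simps)
  moreover have "policy_value I \<pi> \<le> (\<Sum>s=1..T. fixed_term b 1 (\<lambda>_. Map.empty) s)"
    unfolding policy_value_eq[OF \<pi>]
    by (rule expected_score_le_fixed[OF \<pi> _ _ b]) (auto simp: valid_obs_def)
  moreover have "(\<Sum>s=1..T. fixed_term b 1 (\<lambda>_. Map.empty) s) = (\<Sum>s=1..T. 1 - (1 - q) ^ b s)"
    by (intro sum.cong) (auto simp: fixed_term_def)
  ultimately show ?thesis by linarith
qed

subsection \<open>Searching every round until the first success\<close>

text \<open>The second disjunct keeps the policy legal when nothing is left to select; a run that
  gets there has spent its whole budget and halted.\<close>

definition greedy :: "(nat, nat) policy" where
  "greedy t ob = (if 1 \<in> ran (ob t) \<or> {..<n} \<subseteq> dom (ob t) then Advance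
     else Select (LEAST v. v \<notin> dom (ob t)))"

lemma greedy_Select:
  assumes "greedy t ob = Select v"
  shows "v < n" "v \<notin> dom (ob t)" "1 \<notin> ran (ob t)"
proof -
  from assms obtain u where u: "u < n" "u \<notin> dom (ob t)"
    and v: "v = (LEAST v. v \<notin> dom (ob t))" and "1 \<notin> ran (ob t)"
    unfolding greedy_def by (auto split: if_splits)
  then show "v < n" "v \<notin> dom (ob t)" "1 \<notin> ran (ob t)"
    using LeastI[of "\<lambda>v. v \<notin> dom (ob t)", OF u(2)] Least_le[of "\<lambda>v. v \<notin> dom (ob t)", OF u(2)]
    by auto
qed

lemma adaptive_greedy: "adaptive_policy I greedy"
  using greedy_Select by (auto simp: adaptive_policy_def)

text \<open>The expectation of \<open>(k + X) / 2 - ((k - X)\<^sup>2 / c + c) / 4\<close> for \<open>X\<close> binomial with parameters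
  \<open>r\<close> and \<open>q\<close>; this quadratic minorizes \<open>min k X\<close>, the number of successes among \<open>r\<close>
  trials in \<open>k\<close> rounds.\<close>

definition potential :: "real \<Rightarrow> real \<Rightarrow> real \<Rightarrow> real" where
  "potential c k r = (k + q * r) / 2 - ((k - q * r)\<^sup>2 + r * q * (1 - q)) / (4 * c) - c / 4"

text \<open>Conditioning on the first of \<open>r\<close> trials: the quadratic g satisfies g(k, 1 +
  x) = 1 + g(k - 1, x), so a success counts 1 and leaves \<open>k - 1\<close> rounds.\<close>

lemma potential_step:
  assumes "c > 0"
  shows "potential c k r = q * (1 + potential c (k - 1) (r - 1)) + (1 - q) * potential c k (r - 1)"
  using assms by (simp add: potential_def field_simps power2_eq_square)

lemma potential_nonpos:
  assumes "c > 0" "0 \<le> r" "k = 0 \<or> r = 0"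
  shows "potential c k r \<le> 0"
proof -
  \<comment> \<open>As \<open>k * (q * r) = 0\<close>, the squares of \<open>k - q * r\<close> and
    \<open>k + q * r\<close> agree, and the square can be completed.\<close>
  have "potential c k r = - ((k + q * r - c)\<^sup>2 + r * q * (1 - q)) / (4 * c)"
    using assms by (auto simp: potential_def field_simps power2_eq_square)
  moreover have "0 \<le> (k + q * r - c)\<^sup>2 + r * q * (1 - q)"
    using assms(2) q by (intro add_nonneg_nonneg mult_nonneg_nonneg) auto
  ultimately show ?thesis using assms(1) by (simp add: divide_nonpos_pos)
qed

text \<open>The second argument counts the rounds that can still be won: \<open>t\<close> to
  \<open>T\<close>, except \<open>t\<close> itself after a success. At \<open>t = T + 1\<close> the
  emptiness assumption keeps this count from becoming -1.\<close>

lemma potential_halted: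
  assumes "c > 0" "halted I (t, ob)" "t \<le> Suc T" "t > T \<Longrightarrow> ob t = Map.empty" "spent I ob \<le> n"
  shows "potential c (real T + 1 - real t - of_bool (1 \<in> ran (ob t))) (real n - real (spent I ob)) \<le> 0"
proof (rule potential_nonpos[OF assms(1)])
  show "real T + 1 - real t - of_bool (1 \<in> ran (ob t)) = 0 \<or> real n - real (spent I ob) = 0"
  proof (cases "t = Suc T")
    case True
    then have "ob t = Map.empty" using assms(4) by simp
    then show ?thesis using True by simp
  next
    case False
    then show ?thesis using assms(2,3) by (simp add: halted_def)
  qed
qed (use assms(5) in simp)

text \<open>Score plus potential is constant on average along a greedy run, and the potential is at
  most 0 at its end. Each step before halting raises \<open>t + spent I ob\<close> by one, so the
  last assumption says that \<open>k\<close> steps suffice to halt.\<close>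

lemma greedy_ge_potential:
  assumes c: "c > 0"
    and "valid_obs I ob" "1 \<le> t" "\<And>s. s > t \<Longrightarrow> ob s = Map.empty" "t > T \<Longrightarrow> ob t = Map.empty"
    and "spent I ob \<le> n" "t \<le> Suc T" "halted I (t, ob) \<or> Suc (T + n) \<le> t + spent I ob + k"
  shows "score ob + potential c (real T + 1 - real t - of_bool (1 \<in> ran (ob t))) (real n - real (spent I ob))
    \<le> expected_score greedy k t ob"
  using assms(2-)
proof (induction k arbitrary: t ob)
  case 0
  have "halted I (t, ob)" using 0(5,7) by (simp add: halted_def) linarith
  then show ?case using potential_halted[OF c _ 0(6,4,5)] by simp
next
  case (Suc k)
  let ?r = "real n - real (spent I ob)"
  show ?case
  proof (cases "halted I (t, ob)")
    case True
    then show ?thesis using potential_halted[OF c _ Suc.prems(6,4,5)] by simp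
  next
    case False
    then have t: "t \<in> {1..T}" and lt: "spent I ob < n"
      using Suc.prems(2,5) by (auto simp: halted_def)
    show ?thesis
    proof (cases "greedy t ob")
      case Advance
      \<comment> \<open>Trying all items of one round would have used up the budget, so greedy
        leaves a round only after a success.\<close>
      have "\<not> {..<n} \<subseteq> dom (ob t)"
      proof
        assume "{..<n} \<subseteq> dom (ob t)"
        then have "n \<le> card (dom (ob t))"
          using card_mono[OF finite_dom[OF Suc.prems(1)], of "{..<n}" t] by simp
        also have "\<dots> \<le> spent I ob"
          unfolding spent_def using t by (intro member_le_sum) auto
        finally show False using lt by simp
      qed
      then have ran: "1 \<in> ran (ob t)"
        using Advance unfolding greedy_def by (auto split: if_splits)
      \<comment> \<open>Advancing lowers the round count by one, but the correction for the success
        in round \<open>t\<close> disappears, so the potential stays the same.\<close>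
      have "score ob + potential c (real T + 1 - real (Suc t) - of_bool (1 \<in> ran (ob (Suc t)))) ?r
          \<le> expected_score greedy k (Suc t) ob"
      proof (rule Suc.IH)
        show "ob s = Map.empty" if "Suc t < s" for s using Suc.prems(3) that by simp
        show "ob (Suc t) = Map.empty" using Suc.prems(3) by simp
      qed (use Suc.prems(1,5,7) False t in auto)
      then show ?thesis
        using False Advance ran Suc.prems(3)[of "Suc t"] by simp
    next
      case (Select v)
      note v = greedy_Select[OF Select]
      have IH: "score (observe ob t v h) + potential c
            (real T + 1 - real t - of_bool (1 \<in> ran (observe ob t v h t)))
            (real n - real (spent I (observe ob t v h)))
          \<le> expected_score greedy k t (observe ob t v h)" if "h \<in> {0, 1}" for h
      proof (rule Suc.IH)
        have "spent I (observe ob t v h) = Suc (spent I ob)"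
          using spent_update[OF Suc.prems(1), of t v h] t v by simp
        then show "spent I (observe ob t v h) \<le> n"
          and "halted I (t, observe ob t v h) \<or> Suc (T + n) \<le> t + spent I (observe ob t v h) + k"
          using Suc.prems(7) False lt by simp_all
        show "valid_obs I (observe ob t v h)"
          by (rule valid_obs_observe[OF Suc.prems(1) v(1) that])
        show "observe ob t v h s = Map.empty" if "t < s" for s using Suc.prems(3) that by simp
      qed (use Suc.prems(2,6) t in auto)
      have spent: "spent I (observe ob t v h) = Suc (spent I ob)" for h
        using spent_update[OF Suc.prems(1), of t v h] t v by simp
      let ?k = "real T + 1 - real t"
      have "score ob + (1 + potential c (?k - 1) (?r - 1)) \<le> expected_score greedy k t (observe ob t v 1)"
        using IH[of 1] score_observe(1)[of t ob v, OF t v(3,2)] v(2)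
        by (simp add: spent ran_map_upd domIff algebra_simps)
      moreover have "score ob + potential c ?k (?r - 1) \<le> expected_score greedy k t (observe ob t v 0)"
        using IH[of 0] score_observe(2)[of t ob v, OF t v(3,2)] v(2,3)
        by (simp add: spent ran_map_upd domIff algebra_simps)
      ultimately have "q * (score ob + (1 + potential c (?k - 1) (?r - 1)))
          + (1 - q) * (score ob + potential c ?k (?r - 1)) \<le> expected_score greedy (Suc k) t ob"
        using False Select q by (simp add: add_mono mult_left_mono)
      moreover have "q * (score ob + (1 + potential c (?k - 1) (?r - 1)))
          + (1 - q) * (score ob + potential c ?k (?r - 1)) = score ob + potential c ?k ?r"
        by (subst potential_step[OF c, of ?k ?r]) (simp add: algebra_simps)
      ultimately show ?thesis using v(3) by simp
    qed
  qed
qed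

text \<open>With \<open>q * n = T\<close> the squared bias vanishes and the variance is
  \<open>T * (1 - q)\<close>. The choice \<open>c = sqrt T\<close> makes the variance term and the
  term \<open>c / 4\<close> cost at most \<open>sqrt T / 4\<close> each.\<close>

lemma greedy_value_ge:
  assumes "q * n = T"
  shows "T - sqrt T / 2 \<le> policy_value I greedy"
proof -
  have c: "0 < sqrt T" using T by simp
  have "T - sqrt T / 2 \<le> potential (sqrt T) T n"
  proof -
    have "potential (sqrt T) T n = T - T * (1 - q) / (4 * sqrt T) - sqrt T / 4"
      using assms by (simp add: potential_def mult.commute)
    moreover have "T * (1 - q) / (4 * sqrt T) = sqrt T * (1 - q) / 4"
      using real_div_sqrt[of T] by (simp add: divide_divide_eq_left' flip: times_divide_eq_left)
    moreover have "sqrt T * (1 - q) \<le> sqrt T * 1"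
      using q by (intro mult_left_mono) auto
    ultimately show ?thesis by simp
  qed
  also have "\<dots> = score (\<lambda>_. Map.empty) + potential (sqrt T)
      (real T + 1 - real 1 - of_bool (1 \<in> ran (Map.empty :: nat \<rightharpoonup> nat)))
      (real n - real (spent I (\<lambda>_. Map.empty)))"
    by (simp add: score_def spent_def)
  also have "\<dots> \<le> expected_score greedy (T + n) 1 (\<lambda>_. Map.empty)"
    by (rule greedy_ge_potential[OF c]) (auto simp: valid_obs_def spent_def)
  finally show ?thesis by (simp add: policy_value_eq[OF adaptive_greedy])
qed

subsection \<open>Existence of optimal policies\<close>

text \<open>There are infinitely many policies, but a value depends only on the sets selected for
  the finitely many states of positive probability. Hence optima are attained.\<close>

lemma finite_policy_values: "finite (policy_value I ` Collect (adaptive_policy I))"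
proof -
  define val where "val g = measure_pmf.expectation M (\<lambda>\<eta>. \<Sum>t=1..T. objective I t (g \<eta> t) (\<eta> t))"
    for g :: "(nat \<Rightarrow> nat \<Rightarrow> nat) \<Rightarrow> nat \<Rightarrow> nat set"
  define G where "G = (set_pmf M \<rightarrow>\<^sub>E ({1..T} \<rightarrow>\<^sub>E Pow {..<n}))"
  have "policy_value I \<pi> \<in> val ` G" if "adaptive_policy I \<pi>" for \<pi>
  proof
    \<comment> \<open>Restricting to the support and to the actual rounds makes the selection an
      element of a finite function space.\<close>
    let ?g = "\<lambda>\<eta>\<in>set_pmf M. \<lambda>t\<in>{1..T}. selected I \<pi> \<eta> t"
    have "selected I \<pi> \<eta> t \<subseteq> {..<n}" if "\<eta> \<in> set_pmf M" for \<eta> t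
      using run_policy_halted(2)[OF is_instance \<open>adaptive_policy I \<pi>\<close>, of \<eta>] set_M[OF that]
      unfolding selected_def valid_obs_def by simp
    then show "?g \<in> G" by (simp add: G_def)
    show "policy_value I \<pi> = val ?g"
      unfolding policy_value_def val_def state_dist_eq I_simps
      by (intro integral_cong_AE AE_pmfI) (auto intro!: sum.cong)
  qed
  then have "policy_value I ` Collect (adaptive_policy I) \<subseteq> val ` G" by blast
  moreover have "finite G"
    unfolding G_def by (intro finite_PiE finite_M) auto
  ultimately show ?thesis using finite_surj by blast
qed

lemma exists_optimal:
  assumes "A \<subseteq> Collect (adaptive_policy I)" "A \<noteq> {}"
  shows "\<exists>\<pi>\<in>A. \<forall>\<pi>'\<in>A. policy_value I \<pi>' \<le> policy_value I \<pi>"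
proof -
  have fin: "finite (policy_value I ` A)"
    by (rule finite_subset[OF image_mono[OF assms(1)] finite_policy_values])
  have "Max (policy_value I ` A) \<in> policy_value I ` A"
    using fin assms(2) by (intro Max_in) auto
  then show ?thesis using Max_ge[OF fin] by fastforce
qed

lemma exists_optimal_adaptive: "\<exists>\<pi>. optimal_adaptive I \<pi>"
  using exists_optimal[of "Collect (adaptive_policy I)"] adaptive_greedy
  by (auto simp: optimal_adaptive_def)

text \<open>A partially adaptive policy of positive value: it shows that an optimal one exists and
  that its value can be a denominator.\<close>

definition single_trial :: "(nat, nat) policy" where
  "single_trial t ob = (if t = 1 \<and> dom (ob 1) = {} then Select 0 else Advance)"

lemma partially_adaptive_single_trial: "partially_adaptive_policy I single_trial"
proof -
  have "adaptive_policy I single_trial"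
    using n by (auto simp: adaptive_policy_def single_trial_def split: if_splits)
  moreover have "(\<Sum>t=1..T. of_bool (t = 1)) \<le> n"
    using n T by (simp add: sum.If_cases of_bool_def)
  moreover have "(\<exists>v. single_trial t ob = Select v) \<longleftrightarrow> card (dom (ob t)) < of_bool (t = 1)"
    if "valid_obs I ob" for t ob
    using finite_dom[OF that] by (auto simp: single_trial_def)
  ultimately show ?thesis
    unfolding partially_adaptive_policy_def by (auto intro!: exI[of _ "\<lambda>t. of_bool (t = 1)"])
qed

lemma expected_score_nonneg: "0 \<le> expected_score \<pi> k t ob"
  using q by (induction k arbitrary: t ob) (auto simp: score_def sum_nonneg split: action.split)

text \<open>A success in round 1 means that the only trial has been made; from then on the policy
  just advances and the score stays.\<close>

lemma expected_score_single_trial: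
  assumes "1 \<in> ran (ob 1)"
  shows "1 \<le> expected_score single_trial k t ob"
  using assms
proof (induction k arbitrary: t)
  have "of_bool (1 \<in> ran (ob 1)) \<le> score ob"
    unfolding score_def using T by (intro member_le_sum) auto
  then have score: "1 \<le> score ob" using assms by simp
  {
    case 0
    then show ?case using score by simp
  next
    case (Suc k)
    then show ?case using score by (auto simp: single_trial_def)
  }
qed

lemma single_trial_pos: "0 < policy_value I single_trial"
proof -
  obtain k where k: "T + n = Suc k" using T by (cases "T + n") auto
  have "\<not> halted I (1, \<lambda>_. Map.empty)" using T n by (simp add: halted_def spent_def)
  then have "expected_score single_trial (T + n) 1 (\<lambda>_. Map.empty)
      = q * expected_score single_trial k 1 (observe (\<lambda>_. Map.empty) 1 0 1)
      + (1 - q) * expected_score single_trial k 1 (observe (\<lambda>_. Map.empty) 1 0 0)"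
    unfolding k by (simp add: single_trial_def)
  also have "\<dots> \<ge> q * 1 + (1 - q) * 0"
    using q expected_score_nonneg expected_score_single_trial[of "observe (\<lambda>_. Map.empty) 1 0 1"]
    by (intro add_mono mult_left_mono) auto
  finally show ?thesis
    using q partially_adaptive_single_trial
    by (simp add: partially_adaptive_policy_def policy_value_eq)
qed

lemma exists_optimal_partially_adaptive: "\<exists>\<pi>. optimal_partially_adaptive I \<pi> \<and> 0 < policy_value I \<pi>"
proof -
  have "Collect (partially_adaptive_policy I) \<subseteq> Collect (adaptive_policy I)"
    by (auto simp: partially_adaptive_policy_def)
  from exists_optimal[OF this] have "\<exists>\<pi>. optimal_partially_adaptive I \<pi>"
    unfolding optimal_partially_adaptive_def using partially_adaptive_single_trial by blast
  then show ?thesis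
    using partially_adaptive_single_trial single_trial_pos
    by (metis optimal_partially_adaptive_def less_le_trans)
qed

end

section \<open>The limit of the ratios\<close>

theorem theorem4:
  shows "\<exists>p :: real poly.
    ereal (exp 1 / (exp 1 - 1)) \<le> budget_adaptivity_gap p \<and>
    (\<forall>\<epsilon>::real. \<epsilon> > 0 \<longrightarrow>
      (\<exists>(I :: (nat, nat) sbmsm) \<pi>opt \<pi>.
         sbmsm_instance I \<and> standing_assumptions p I \<and>
         optimal_adaptive I \<pi>opt \<and> optimal_partially_adaptive I \<pi> \<and>
         policy_value I \<pi> > 0 \<and>
         policy_value I \<pi>opt / policy_value I \<pi> > exp 1 / (exp 1 - 1) - \<epsilon>))"
proof (intro exI[of _ "[:0, 1:]"] conjI)
  \<comment> \<open>The greedy lower bound divided by the partially adaptive upper bound for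
    \<open>T = m = N\<close>, with the common factor \<open>N\<close> cancelled.\<close>
  define \<rho> where "\<rho> N = (1 - 1 / (2 * sqrt (real N))) / (1 - (1 - 1 / real N) ^ N)" for N :: nat
  have "(\<lambda>N. (1 + (- 1) / real N) ^ N) \<longlonglongrightarrow> exp (- 1)"
    by (rule tendsto_exp_limit_sequentially)
  then have "(\<lambda>N. (1 - 1 / real N) ^ N) \<longlonglongrightarrow> exp (- 1)" by simp
  moreover have "(\<lambda>N. 1 / (2 * sqrt (real N))) \<longlonglongrightarrow> 0" by real_asymp
  moreover have "1 - exp (- 1) \<noteq> (0 :: real)" by simp
  ultimately have "\<rho> \<longlonglongrightarrow> (1 - 0) / (1 - exp (- 1))"
    unfolding \<rho>_def by (intro tendsto_intros)
  moreover have "(1 - 0) / (1 - exp (- 1)) = exp 1 / (exp 1 - 1 :: real)"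
    by (simp add: exp_minus field_simps)
  ultimately have \<rho>: "\<rho> \<longlonglongrightarrow> exp 1 / (exp 1 - 1)" by simp
  show ex: "\<forall>\<epsilon>::real. \<epsilon> > 0 \<longrightarrow>
      (\<exists>(I :: (nat, nat) sbmsm) \<pi>opt \<pi>.
         sbmsm_instance I \<and> standing_assumptions [:0, 1:] I \<and>
         optimal_adaptive I \<pi>opt \<and> optimal_partially_adaptive I \<pi> \<and>
         policy_value I \<pi> > 0 \<and>
         policy_value I \<pi>opt / policy_value I \<pi> > exp 1 / (exp 1 - 1) - \<epsilon>)"
  proof (intro allI impI)
    fix \<epsilon> :: real assume "\<epsilon> > 0"
    then have "eventually (\<lambda>N. \<rho> N > exp 1 / (exp 1 - 1) - \<epsilon>) sequentially"
      by (intro order_tendstoD(1)[OF \<rho>]) simp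
    then obtain N0 where N0: "\<And>N. N \<ge> N0 \<Longrightarrow> \<rho> N > exp 1 / (exp 1 - 1) - \<epsilon>"
      by (auto simp: eventually_sequentially)
    define N where "N = max 2 N0"
    have N: "2 \<le> N" "\<rho> N > exp 1 / (exp 1 - 1) - \<epsilon>" using N0 by (auto simp: N_def)
    \<comment> \<open>The whole budget yields \<open>N\<close> successes on average, one for each of
      the \<open>N\<close> rounds; \<open>N \<ge> 2\<close> gives \<open>q < 1\<close> and at least
      two rounds.\<close>
    interpret search "1 / real N" N "N * N"
      using N(1) mult_le_mono[OF N(1) N(1)] by unfold_locales auto
    obtain \<pi>opt where opt: "optimal_adaptive I \<pi>opt" using exists_optimal_adaptive by blast
    obtain \<pi> where part: "optimal_partially_adaptive I \<pi>" "0 < policy_value I \<pi>"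
      using exists_optimal_partially_adaptive by blast
    have "N - sqrt N / 2 \<le> policy_value I greedy"
      using N(1) by (intro greedy_value_ge) simp
    also have "\<dots> \<le> policy_value I \<pi>opt"
      using opt adaptive_greedy by (simp add: optimal_adaptive_def)
    finally have lower: "N - sqrt N / 2 \<le> policy_value I \<pi>opt" .
    have upper: "policy_value I \<pi> \<le> N * (1 - (1 - 1 / N) ^ N)"
      using part(1) by (intro partially_adaptive_value_le) (simp_all add: optimal_partially_adaptive_def)
    have "N - sqrt N / 2 = N * (1 - 1 / (2 * sqrt N))"
      using N(1) by (simp add: field_simps)
    then have "\<rho> N = (N - sqrt N / 2) / (N * (1 - (1 - 1 / N) ^ N))"
      using N(1) by (simp add: \<rho>_def)
    also have "\<dots> \<le> policy_value I \<pi>opt / policy_value I \<pi>"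
    proof (rule frac_le[OF _ lower part(2) upper])
      have "sqrt N \<le> N" using N(1) by (intro real_le_lsqrt) (auto simp: power2_eq_square)
      then show "0 \<le> policy_value I \<pi>opt" using lower by linarith
    qed
    finally have "policy_value I \<pi>opt / policy_value I \<pi> > exp 1 / (exp 1 - 1) - \<epsilon>"
      using N(2) by linarith
    moreover have "standing_assumptions [:0, 1:] I"
      by (rule standing_assumptions_hold) simp
    ultimately show "\<exists>(I :: (nat, nat) sbmsm) \<pi>opt \<pi>.
         sbmsm_instance I \<and> standing_assumptions [:0, 1:] I \<and>
         optimal_adaptive I \<pi>opt \<and> optimal_partially_adaptive I \<pi> \<and>
         policy_value I \<pi> > 0 \<and>
         policy_value I \<pi>opt / policy_value I \<pi> > exp 1 / (exp 1 - 1) - \<epsilon>"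
      using is_instance opt part by blast
  qed
  show "ereal (exp 1 / (exp 1 - 1)) \<le> budget_adaptivity_gap [:0, 1:]"
  proof (rule ereal_le_epsilon2)
    fix \<epsilon> :: real assume "0 < \<epsilon>"
    with ex obtain I :: "(nat, nat) sbmsm" and \<pi>opt \<pi> where I:
      "sbmsm_instance I" "standing_assumptions [:0, 1:] I" "optimal_adaptive I \<pi>opt"
      "optimal_partially_adaptive I \<pi>" "policy_value I \<pi> > 0"
      and gap: "policy_value I \<pi>opt / policy_value I \<pi> > exp 1 / (exp 1 - 1) - \<epsilon>"
      by blast
    have "ereal (exp 1 / (exp 1 - 1)) \<le> ereal (policy_value I \<pi>opt / policy_value I \<pi>) + ereal \<epsilon>"
      using gap by simp
    also have "ereal (policy_value I \<pi>opt / policy_value I \<pi>) \<le> budget_adaptivity_gap [:0, 1:]"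
      unfolding budget_adaptivity_gap_def using I by (intro Sup_upper) blast
    finally show "ereal (exp 1 / (exp 1 - 1)) \<le> budget_adaptivity_gap [:0, 1:] + ereal \<epsilon>"
      by (simp add: add_right_mono)
  qed
qed

end
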